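(* Let $c_1\in(0,1)$ and $\vartheta>1$. Let $z_{k-1}\ne z_k$ in $\mathbb{R}^{n+1}$, $s_{k-1}=z_k-z_{k-1}$, let $b_k\in\mathbb{R}^{n+1}$ be nonzero, $g_k=\nabla\Phi_\tau(z_k)$, and let $d_k$ be the enhanced three-term direction defined in the context with some $0\le\mu_k\le\mu_k^\star$. Then every $\alpha$ with $$0<\alpha\le 2(1-c_1)\zeta_\vartheta,\qquad \zeta_\vartheta=1-\vartheta^{-2},$$ satisfies the Armijo condition $$\Phi_\tau(z_k+\alpha d_k)\le\Phi_\tau(z_k)+c_1\alpha\,g_k^Td_k .$$
   Context: Let $f_1,\dots,f_m\in C^1(\mathbb{R}^n)$ have gradients that are Lipschitz on $\mathbb{R}^n$ with constants $L_i\ge0$; $\bar L=\sum_i L_i$; $\tau>0$, $\delta>0$. Let $\phi_\tau(r)=\frac{r+\sqrt{r^2+\tau^2}}{2}$ and $\Phi_\tau(x,t)=t+\sum_{i=1}^m\phi_\tau(f_i(x)-t)$ on $\mathbb{R}^{n+1}$. At $z_k=(x_k,t_k)$ let $\omega_{i,k}=\sqrt{(f_i(x_k)-t_k)^2+\tau^2}$, $J_k$ the $m\times(n+1)$ matrix with rows $(\nabla f_i(x_k)^T,-1)$, $D_k=\operatorname{diag}(\omega_{1,k}^{-1},\dots,\omega_{m,k}^{-1})$, $\Pi_x=\operatorname{diag}(I_n,0)$, and $P_k=\delta I_{n+1}+\bar L\Pi_x+\frac12J_k^TD_kJ_k$, a symmetric positive definite matrix. Put $C_k=s_{k-1}^TP_ks_{k-1}$,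 $B_k=b_k^TP_k^{-1}b_k$, $\Delta_k=s_{k-1}^Tb_k$, $\chi_k=\Delta_k/\sqrt{C_kB_k}\in[-1,1]$, $\mathcal{D}_k=\Delta_k+\vartheta\sqrt{C_kB_k}$ (positive), $\varpi_k^2=\frac{1-\chi_k^2}{(\vartheta+\chi_k)^2}$, $\Gamma_0=\frac{\vartheta^2}{\vartheta^2-1}$, $\mu_k^\star=\frac{\Gamma_0-1-\varpi_k^2}{\sqrt{\Gamma_0}+1}$. For $\mu_k\ge0$ the enhanced direction is $$d_k=-P_k^{-1}g_k+\left[\frac{g_k^TP_k^{-1}b_k}{\mathcal{D}_k}-\mu_k\frac{g_k^Ts_{k-1}}{C_k}\right]s_{k-1}-\frac{g_k^Ts_{k-1}}{\mathcal{D}_k}P_k^{-1}b_k.$$ *)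

theory Defs
  imports "HOL-Analysis.Analysis"
begin

text \<open>Only meaningful where \<open>f\<close> is differentiable.\<close>

definition grad :: "('a::euclidean_space \<Rightarrow> real) \<Rightarrow> 'a \<Rightarrow> 'a" where
  "grad f x = (THE D. GDERIV f x :> D)"

lemma grad_eqI: "GDERIV f x :> D \<Longrightarrow> grad f x = D"
  unfolding grad_def
proof (rule the_equality)
  fix E assume "GDERIV f x :> D" "GDERIV f x :> E"
  then have "(\<lambda>h. h \<bullet> E) = (\<lambda>h. h \<bullet> D)"
    unfolding gderiv_def by (rule has_derivative_unique[rotated])
  then show "E = D"
    by (metis vector_eq_ldot)
qed

lemma GDERIV_grad:
  assumes "f differentiable (at x)"
  shows "GDERIV f x :> grad f x"
proof -
  from assms obtain f' where f': "(f has_derivative f') (at x)"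
    unfolding differentiable_def by blast
  then interpret bounded_linear f'
    by (rule has_derivative_bounded_linear)
  have "f' = (\<lambda>h. h \<bullet> adjoint f' 1)"
    using adjoint_works[OF linear_axioms, of _ 1] by (auto simp: fun_eq_iff)
  with f' have "GDERIV f x :> adjoint f' 1"
    unfolding gderiv_def by simp
  then show ?thesis
    by (metis grad_eqI)
qed

text \<open>
  The space \<open>\<real>\<^sup>n\<^sup>+\<^sup>1\<close> is the type \<open>real^('n option)\<close>: for \<open>z = (x, t)\<close>, the components of \<open>x\<close>
  are indexed by \<open>Some j\<close> and \<open>t\<close> is the component indexed by \<open>None\<close>.
\<close>

definition xpart :: "real^('n::finite option) \<Rightarrow> real^'n" where
  "xpart z = (\<chi> j. z $ Some j)"

definition tpart :: "real^('n::finite option) \<Rightarrow> real" where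
  "tpart z = z $ None"

definition diag :: "('a::finite \<Rightarrow> real) \<Rightarrow> real^'a^'a" where
  "diag w = (\<chi> i j. if i = j then w i else 0)"

definition phi :: "real \<Rightarrow> real \<Rightarrow> real" where
  "phi \<tau> r = (r + sqrt (r\<^sup>2 + \<tau>\<^sup>2)) / 2"

definition Phi :: "real \<Rightarrow> ('m::finite \<Rightarrow> real^'n::finite \<Rightarrow> real) \<Rightarrow> real^('n option) \<Rightarrow> real" where
  "Phi \<tau> f z = tpart z + (\<Sum>i\<in>UNIV. phi \<tau> (f i (xpart z) - tpart z))"

definition omega :: "real \<Rightarrow> ('m::finite \<Rightarrow> real^'n::finite \<Rightarrow> real) \<Rightarrow> real^('n option) \<Rightarrow> 'm \<Rightarrow> real" where
  "omega \<tau> f z i = sqrt ((f i (xpart z) - tpart z)\<^sup>2 + \<tau>\<^sup>2)"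

definition Jmat :: "('m::finite \<Rightarrow> real^'n::finite \<Rightarrow> real) \<Rightarrow> real^('n option) \<Rightarrow> real^('n option)^'m" where
  "Jmat f z = (\<chi> i j. case j of Some l \<Rightarrow> grad (f i) (xpart z) $ l | None \<Rightarrow> -1)"

definition Dmat :: "real \<Rightarrow> ('m::finite \<Rightarrow> real^'n::finite \<Rightarrow> real) \<Rightarrow> real^('n option) \<Rightarrow> real^'m^'m" where
  "Dmat \<tau> f z = diag (\<lambda>i. inverse (omega \<tau> f z i))"

definition Pi_x :: "real^('n::finite option)^('n option)" where
  "Pi_x = diag (\<lambda>j. case j of Some l \<Rightarrow> 1 | None \<Rightarrow> 0)"

definition Pmat ::
  "real \<Rightarrow> real \<Rightarrow> ('m::finite \<Rightarrow> real) \<Rightarrow> ('m \<Rightarrow> real^'n::finite \<Rightarrow> real) \<Rightarrow> real^('n option)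
    \<Rightarrow> real^('n option)^('n option)" where
  "Pmat \<tau> \<delta> L f z =
     \<delta> *\<^sub>R mat 1 + (\<Sum>i\<in>UNIV. L i) *\<^sub>R Pi_x
       + (1/2) *\<^sub>R (transpose (Jmat f z) ** Dmat \<tau> f z ** Jmat f z)"

text \<open>
  The scalars and the direction depend on the iterate only through \<open>P = P\<^sub>k\<close>, \<open>s = s\<^sub>k\<^sub>-\<^sub>1\<close>,
  \<open>b = b\<^sub>k\<close> and \<open>g = g\<^sub>k\<close>.
\<close>

definition Cval :: "real^'d^'d \<Rightarrow> real^'d \<Rightarrow> real" where
  "Cval P s = s \<bullet> (P *v s)"

definition Bval :: "real^'d^'d \<Rightarrow> real^'d \<Rightarrow> real" where
  "Bval P b = b \<bullet> (matrix_inv P *v b)"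

definition chi :: "real^'d^'d \<Rightarrow> real^'d \<Rightarrow> real^'d \<Rightarrow> real" where
  "chi P s b = (s \<bullet> b) / sqrt (Cval P s * Bval P b)"

definition Dval :: "real \<Rightarrow> real^'d^'d \<Rightarrow> real^'d \<Rightarrow> real^'d \<Rightarrow> real" where
  "Dval \<theta> P s b = s \<bullet> b + \<theta> * sqrt (Cval P s * Bval P b)"

definition varpi_sq :: "real \<Rightarrow> real^'d^'d \<Rightarrow> real^'d \<Rightarrow> real^'d \<Rightarrow> real" where
  "varpi_sq \<theta> P s b = (1 - (chi P s b)\<^sup>2) / (\<theta> + chi P s b)\<^sup>2"

definition Gamma0 :: "real \<Rightarrow> real" where
  "Gamma0 \<theta> = \<theta>\<^sup>2 / (\<theta>\<^sup>2 - 1)"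

definition mu_star :: "real \<Rightarrow> real^'d^'d \<Rightarrow> real^'d \<Rightarrow> real^'d \<Rightarrow> real" where
  "mu_star \<theta> P s b = (Gamma0 \<theta> - 1 - varpi_sq \<theta> P s b) / (sqrt (Gamma0 \<theta>) + 1)"

definition direction ::
  "real \<Rightarrow> real \<Rightarrow> real^'d^'d \<Rightarrow> real^'d \<Rightarrow> real^'d \<Rightarrow> real^'d \<Rightarrow> real^'d" where
  "direction \<theta> \<mu> P s b g =
     - (matrix_inv P *v g)
     + ((g \<bullet> (matrix_inv P *v b)) / Dval \<theta> P s b - \<mu> * ((g \<bullet> s) / Cval P s)) *\<^sub>R s
     - ((g \<bullet> s) / Dval \<theta> P s b) *\<^sub>R (matrix_inv P *v b)"

end

theory Submission
  imports Defs
begin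

text \<open>
  Two facts, both expressed through the same matrix \<open>P\<close>, give the Armijo condition. Below, \<open>h\<^sub>x\<close> is
  the \<open>x\<close>-part of a step \<open>h\<close>.

  The matrix \<open>P\<close> bounds the curvature of \<open>\<Phi>\<close> globally:
  \<open>\<Phi>(z + h) \<le> \<Phi>(z) + g \<bullet> h + (h \<bullet> P h) / 2\<close> (\<open>Phi_le_quadratic_model\<close>). The nonlinearity of \<open>f\<^sub>i\<close>
  costs at most \<open>L\<^sub>i |h\<^sub>x|\<^sup>2 / 2\<close>, and \<open>\<phi>\<close>, being increasing and 1-Lipschitz, passes this error on
  without magnifying it; this is the block with the sum of the \<open>L\<^sub>i\<close> in \<open>P\<close>. The nonlinearity of
  \<open>\<phi>\<close> costs at most \<open>u\<^sup>2 / (4 \<omega>\<^sub>i)\<close> for a change \<open>u\<close> of the argument, because the square root is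
  concave; for the linearised \<open>u\<close> this is the block with \<open>J\<close>.

  The direction satisfies \<open>d \<bullet> P d \<le> \<Gamma>\<^sub>0 (- g \<bullet> d)\<close>, where \<open>1 / \<Gamma>\<^sub>0 = 1 - 1 / \<theta>\<^sup>2\<close>
  (\<open>direction_sufficient_descent\<close>). In the inner product \<open>\<langle>x, y\<rangle> = x \<bullet> P y\<close>, put \<open>p = P\<^sup>-\<^sup>1 g\<close> and
  \<open>q = P\<^sup>-\<^sup>1 b\<close>. Then \<open>d = - H p\<close>, where \<open>H\<close> is the identity plus \<open>\<mu>\<close> times the orthogonal projection
  onto \<open>s\<close> plus a skew map of the plane of \<open>s\<close> and \<open>q\<close>, which is a quarter turn scaled by \<open>\<varpi>\<close>.
  The claim is \<open>|H p|\<^sup>2 \<le> \<Gamma>\<^sub>0 \<langle>p, H p\<rangle>\<close>. Off that plane \<open>H\<close> is the identity and \<open>\<Gamma>\<^sub>0 \<ge> 1\<close>; on it, in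
  an orthonormal basis starting with the direction of \<open>s\<close>, \<open>H\<close> has the rows \<open>(1 + \<mu>, - \<varpi>)\<close> and
  \<open>(\<varpi>, 1)\<close>. The claim holds whenever \<open>0 \<le> \<mu> \<le> \<Gamma>\<^sub>0 - 1 - \<varpi>\<^sup>2\<close>, by an explicit
  sum of squares (\<open>planar_direction_bound\<close>), and \<open>\<mu>\<^sup>\<star>\<close> lies below this threshold.

  With \<open>h = \<alpha> d\<close>, the quadratic term is at most \<open>\<alpha>\<^sup>2 \<Gamma>\<^sub>0 (- g \<bullet> d) / 2\<close>, which for
  \<open>\<alpha> \<le> 2 (1 - c\<^sub>1) / \<Gamma>\<^sub>0\<close> uses up at most the fraction \<open>1 - c\<^sub>1\<close> of the linear decrease.
\<close>

section \<open>Inequalities for the smoothed maximum\<close>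

lemma descent_lemma:
  fixes f :: "'a::euclidean_space \<Rightarrow> real"
  assumes diff: "\<And>x. f differentiable (at x)"
    and lip: "L-lipschitz_on UNIV (grad f)"
  shows "f (x + h) \<le> f x + grad f x \<bullet> h + L / 2 * (norm h)\<^sup>2"
proof -
  \<comment> \<open>Along the segment, \<open>f\<close> minus the variable part of the claimed bound; the Lipschitz condition
    says that its derivative is nonpositive.\<close>
  define \<psi> where "\<psi> t = f (x + t *\<^sub>R h) - t * (grad f x \<bullet> h) - L / 2 * t\<^sup>2 * (norm h)\<^sup>2" for t
  have deriv: "(\<psi> has_real_derivative
      (grad f (x + t *\<^sub>R h) - grad f x) \<bullet> h - L * t * (norm h)\<^sup>2) (at t)" for t
  proof -
    have "(f has_derivative (\<lambda>v. v \<bullet> grad f (x + t *\<^sub>R h))) (at (x + t *\<^sub>R h))"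
      using GDERIV_grad[OF diff] by (simp add: gderiv_def)
    moreover have "((\<lambda>t. x + t *\<^sub>R h) has_derivative (\<lambda>u. u *\<^sub>R h)) (at t)"
      by (auto intro!: derivative_eq_intros)
    ultimately have "((\<lambda>t. f (x + t *\<^sub>R h)) has_derivative
        (\<lambda>u. (u *\<^sub>R h) \<bullet> grad f (x + t *\<^sub>R h))) (at t)"
      using has_derivative_compose by fastforce
    moreover have "(\<lambda>u. (u *\<^sub>R h) \<bullet> grad f (x + t *\<^sub>R h)) = (*) (grad f (x + t *\<^sub>R h) \<bullet> h)"
      by (simp add: fun_eq_iff inner_commute)
    ultimately have "((\<lambda>t. f (x + t *\<^sub>R h)) has_real_derivative grad f (x + t *\<^sub>R h) \<bullet> h) (at t)"
      by (simp only: has_field_derivative_def)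
    then show ?thesis
      unfolding \<psi>_def by (auto intro!: derivative_eq_intros simp: inner_diff_left)
  qed
  have "(grad f (x + t *\<^sub>R h) - grad f x) \<bullet> h \<le> L * t * (norm h)\<^sup>2" if "0 \<le> t" for t
  proof -
    have "(grad f (x + t *\<^sub>R h) - grad f x) \<bullet> h \<le> norm (grad f (x + t *\<^sub>R h) - grad f x) * norm h"
      by (rule norm_cauchy_schwarz)
    also have "\<dots> \<le> (L * norm (t *\<^sub>R h)) * norm h"
      using lipschitz_onD[OF lip, of "x + t *\<^sub>R h" x]
      by (intro mult_right_mono) (auto simp: dist_norm)
    finally show ?thesis
      using that by (simp add: power2_eq_square mult.assoc)
  qed
  then have "\<psi> 1 \<le> \<psi> 0"
    using deriv by (intro DERIV_nonpos_imp_nonincreasing[of 0 1]) fastforce+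
  then show ?thesis
    by (simp add: \<psi>_def)
qed

text \<open>
  Since \<open>\<phi>\<close> is increasing with slope at most 1, an upper bound on \<open>f\<^sub>i\<close> with some error becomes an
  upper bound on the \<open>i\<close>-th summand of \<open>\<Phi>\<close> with the same error.
\<close>

lemma phi_le_phi_add:
  assumes "r \<le> r' + e" "0 \<le> e"
  shows "phi \<tau> r \<le> phi \<tau> r' + e"
proof -
  have "sqrt (r\<^sup>2 + \<tau>\<^sup>2) \<le> sqrt (r'\<^sup>2 + \<tau>\<^sup>2) + \<bar>r - r'\<bar>"
    using real_sqrt_sum_squares_triangle_ineq[of r' "r - r'" \<tau> 0] by simp
  moreover have "\<bar>r - r'\<bar> + (r - r') \<le> 2 * e"
    using assms by auto
  ultimately show ?thesis
    by (simp add: phi_def field_simps)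
qed

text \<open>
  The square root is concave, so it lies below its tangent at \<open>w\<^sup>2 = r\<^sup>2 + \<tau>\<^sup>2\<close>. The argument
  \<open>(r + u)\<^sup>2 + \<tau>\<^sup>2\<close> exceeds \<open>w\<^sup>2\<close> by \<open>2 r u + u\<^sup>2\<close>: the first term contributes the derivative of
  \<open>\<phi>\<close>, the second is the whole error. This is sharper than the error \<open>u\<^sup>2 / (4 \<tau>)\<close> that
  is valid uniformly in \<open>r\<close>, and is where the weights \<open>1 / \<omega>\<^sub>i\<close> in \<open>P\<close> come from.
\<close>

lemma phi_quadratic_upper_bound:
  fixes \<tau> r u :: real
  assumes "\<tau> > 0"
  defines "w \<equiv> sqrt (r\<^sup>2 + \<tau>\<^sup>2)"
  shows "phi \<tau> (r + u) \<le> phi \<tau> r + (1 + r / w) / 2 * u + u\<^sup>2 / (4 * w)"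
proof -
  have w: "w > 0" "w\<^sup>2 = r\<^sup>2 + \<tau>\<^sup>2"
    using assms by (auto simp: w_def add_nonneg_pos)
  have "sqrt ((r + u)\<^sup>2 + \<tau>\<^sup>2) \<le> w + (2 * r * u + u\<^sup>2) / (2 * w)"
  proof (rule real_le_lsqrt)
    have "w + (2 * r * u + u\<^sup>2) / (2 * w) = (w\<^sup>2 + ((r + u)\<^sup>2 + \<tau>\<^sup>2)) / (2 * w)"
      using w by (simp add: field_simps power2_eq_square)
    also have "\<dots> \<ge> 0"
      using w by simp
    finally show "0 \<le> w + (2 * r * u + u\<^sup>2) / (2 * w)" .
    have "(w + (2 * r * u + u\<^sup>2) / (2 * w))\<^sup>2
        = w\<^sup>2 + (2 * r * u + u\<^sup>2) + ((2 * r * u + u\<^sup>2) / (2 * w))\<^sup>2"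
      using w(1) by (simp add: power2_sum)
    then show "(r + u)\<^sup>2 + \<tau>\<^sup>2 \<le> (w + (2 * r * u + u\<^sup>2) / (2 * w))\<^sup>2"
      using w(2) by (simp add: power2_sum)
  qed
  then show ?thesis
    unfolding phi_def w_def[symmetric] using w(1) by (simp add: field_simps)
qed

section \<open>The quadratic model\<close>

lemma xpart_add [simp]: "xpart (z + h) = xpart z + xpart h"
  by (simp add: xpart_def vec_eq_iff)

lemma tpart_add [simp]: "tpart (z + h) = tpart z + tpart h"
  by (simp add: tpart_def)

lemma bounded_linear_xpart: "bounded_linear xpart"
  by (rule linear_conv_bounded_linear[THEN iffD1], rule linearI) (auto simp: xpart_def vec_eq_iff)

lemma bounded_linear_tpart: "bounded_linear tpart"
  unfolding tpart_def[abs_def] by (rule bounded_linear_vec_nth)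

lemma sum_option:
  fixes F :: "'n::finite option \<Rightarrow> 'a::comm_monoid_add"
  shows "(\<Sum>j\<in>UNIV. F j) = F None + (\<Sum>l\<in>UNIV. F (Some l))"
proof -
  have "(\<Sum>j\<in>UNIV. F j) = F None + sum F (range Some)"
    by (simp add: UNIV_option_conv)
  then show ?thesis
    by (simp add: sum.reindex)
qed

lemma Jmat_mult_vec:
  "(Jmat f z *v h) $ i = grad (f i) (xpart z) \<bullet> xpart h - tpart h"
  by (simp add: Jmat_def matrix_vector_mult_def sum_option inner_vec_def xpart_def tpart_def)

lemma diag_mult_vec: "diag w *v y = (\<chi> i. w i * y $ i)"
proof -
  have "(\<Sum>j\<in>UNIV. (if i = j then w i else 0) * y $ j) = w i * y $ i" for i
    by (simp add: if_distrib[where f = "\<lambda>u. u * _"] cong: if_cong)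
  then show ?thesis
    by (simp add: diag_def matrix_vector_mult_def)
qed

lemma transpose_diag: "transpose (diag w) = diag w"
  by (auto simp: transpose_def diag_def vec_eq_iff)

lemma transpose_add: "transpose (A + B) = transpose A + transpose B"
  by (simp add: transpose_def vec_eq_iff)

lemma Pmat_symmetric: "transpose (Pmat \<tau> \<delta> L f z) = Pmat \<tau> \<delta> L f z"
  by (simp add: Pmat_def transpose_add transpose_scalar matrix_transpose_mul
      Pi_x_def Dmat_def transpose_diag transpose_mat matrix_mul_assoc)

lemma Pmat_quadratic_form:
  "h \<bullet> (Pmat \<tau> \<delta> L f z *v h) = \<delta> * (norm h)\<^sup>2 + (\<Sum>i\<in>UNIV. L i) * (norm (xpart h))\<^sup>2
     + 1/2 * (\<Sum>i\<in>UNIV. (grad (f i) (xpart z) \<bullet> xpart h - tpart h)\<^sup>2 / omega \<tau> f z i)"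
proof -
  have Pi: "h \<bullet> (Pi_x *v h) = (norm (xpart h))\<^sup>2"
    by (simp add: Pi_x_def diag_mult_vec inner_vec_def sum_option xpart_def
        flip: power2_norm_eq_inner)
       (simp add: power2_norm_eq_inner inner_vec_def)
  have "h \<bullet> ((transpose (Jmat f z) ** Dmat \<tau> f z ** Jmat f z) *v h)
      = (Jmat f z *v h) \<bullet> (Dmat \<tau> f z *v (Jmat f z *v h))"
    by (metis dot_lmul_matrix matrix_vector_mul_assoc vector_transpose_matrix transpose_matrix_vector)
  also have "\<dots> = (\<Sum>i\<in>UNIV. (grad (f i) (xpart z) \<bullet> xpart h - tpart h)\<^sup>2 / omega \<tau> f z i)"
    by (simp add: Dmat_def diag_mult_vec inner_vec_def[of "_ *v _"] Jmat_mult_vec power2_eq_square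
        divide_inverse ac_simps)
  finally show ?thesis
    by (simp add: Pmat_def matrix_vector_mult_add_rdistrib scaleR_matrix_vector_assoc[symmetric]
        inner_add_right Pi power2_norm_eq_inner)
qed

lemma Pmat_positive_definite:
  assumes "\<delta> > 0" "\<And>i. L i \<ge> 0" "h \<noteq> 0"
  shows "h \<bullet> (Pmat \<tau> \<delta> L f z *v h) > 0"
  unfolding Pmat_quadratic_form using assms
  by (intro add_pos_nonneg mult_pos_pos mult_nonneg_nonneg sum_nonneg divide_nonneg_nonneg)
     (auto simp: omega_def)

lemma grad_Phi_inner:
  fixes f :: "'m::finite \<Rightarrow> real^'n::finite \<Rightarrow> real"
  assumes diff: "\<And>i x. f i differentiable (at x)" and "\<tau> > 0"
  shows "grad (Phi \<tau> f) z \<bullet> h = tpart h + (\<Sum>i\<in>UNIV.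
     (1 + (f i (xpart z) - tpart z) / omega \<tau> f z i) / 2
       * (grad (f i) (xpart z) \<bullet> xpart h - tpart h))"
proof -
  define r where "r i z = f i (xpart z) - tpart z" for i z
  define r' where "r' i h = grad (f i) (xpart z) \<bullet> xpart h - tpart h" for i h
  have r: "(r i has_derivative r' i) (at z)" for i
  proof -
    have "(f i has_derivative (\<lambda>h. h \<bullet> grad (f i) (xpart z))) (at (xpart z))"
      using GDERIV_grad[OF diff] by (simp add: gderiv_def)
    from has_derivative_compose[OF bounded_linear_imp_has_derivative[OF bounded_linear_xpart] this]
    show ?thesis
      unfolding r_def[abs_def] r'_def[abs_def]
      by (intro has_derivative_diff bounded_linear_imp_has_derivative[OF bounded_linear_tpart])
         (simp add: inner_commute)
  qed
  have phi: "(phi \<tau> has_derivative (\<lambda>h. (1 + x / sqrt (x\<^sup>2 + \<tau>\<^sup>2)) / 2 * h)) (at x)" for x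
  proof -
    have "x\<^sup>2 + \<tau>\<^sup>2 > 0"
      using \<open>\<tau> > 0\<close> by (simp add: add_nonneg_pos)
    then have "(phi \<tau> has_real_derivative (1 + x / sqrt (x\<^sup>2 + \<tau>\<^sup>2)) / 2) (at x)"
      unfolding phi_def[abs_def]
      by (auto intro!: derivative_eq_intros simp: field_simps)
    then show ?thesis
      unfolding has_field_derivative_def .
  qed
  have "((\<lambda>z. tpart z + (\<Sum>i\<in>UNIV. phi \<tau> (r i z))) has_derivative
      (\<lambda>h. tpart h + (\<Sum>i\<in>UNIV. (1 + r i z / sqrt ((r i z)\<^sup>2 + \<tau>\<^sup>2)) / 2 * r' i h))) (at z)"
    by (intro has_derivative_add has_derivative_sum has_derivative_compose[OF r phi]
        bounded_linear_imp_has_derivative[OF bounded_linear_tpart])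
  then have D: "(Phi \<tau> f has_derivative
      (\<lambda>h. tpart h + (\<Sum>i\<in>UNIV. (1 + r i z / omega \<tau> f z i) / 2 * r' i h))) (at z)"
    by (simp add: Phi_def[abs_def] omega_def r_def)
  then have "(Phi \<tau> f has_derivative (\<lambda>h. h \<bullet> grad (Phi \<tau> f) z)) (at z)"
    using GDERIV_grad[of "Phi \<tau> f" z] by (auto simp: gderiv_def differentiable_def)
  from has_derivative_unique[OF this D] show ?thesis
    by (simp add: fun_eq_iff r_def r'_def inner_commute)
qed

text \<open>
  For each \<open>i\<close>, the true change of \<open>f\<^sub>i(x) - t\<close> is first replaced by its linearisation \<open>l\<^sub>i\<close>, at the
  cost of the descent lemma, and only then is \<open>\<phi>\<close> expanded; so the quadratic error of \<open>\<phi>\<close> is a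
  quadratic form in the step.
\<close>

lemma Phi_le_quadratic_model:
  fixes f :: "'m::finite \<Rightarrow> real^'n::finite \<Rightarrow> real"
  assumes diff: "\<And>i x. f i differentiable (at x)"
    and lip: "\<And>i. (L i)-lipschitz_on UNIV (grad (f i))"
    and "\<tau> > 0" "\<delta> > 0"
  shows "Phi \<tau> f (z + h) \<le> Phi \<tau> f z + grad (Phi \<tau> f) z \<bullet> h
           + 1/2 * (h \<bullet> (Pmat \<tau> \<delta> L f z *v h))"
proof -
  define r where "r i = f i (xpart z) - tpart z" for i
  define l where "l i = grad (f i) (xpart z) \<bullet> xpart h - tpart h" for i
  define w where "w i = omega \<tau> f z i" for i
  have "phi \<tau> (f i (xpart (z + h)) - tpart (z + h))
      \<le> phi \<tau> (r i) + (1 + r i / w i) / 2 * l i + (l i)\<^sup>2 / (4 * w i)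
         + L i / 2 * (norm (xpart h))\<^sup>2" for i
  proof -
    have "phi \<tau> (f i (xpart (z + h)) - tpart (z + h))
        \<le> phi \<tau> (r i + l i) + L i / 2 * (norm (xpart h))\<^sup>2"
      using descent_lemma[OF diff lip, of i "xpart z" "xpart h"] lipschitz_on_nonneg[OF lip[of i]]
      by (intro phi_le_phi_add) (auto simp: r_def l_def)
    also have "phi \<tau> (r i + l i) \<le> phi \<tau> (r i) + (1 + r i / w i) / 2 * l i + (l i)\<^sup>2 / (4 * w i)"
      using phi_quadratic_upper_bound[OF \<open>\<tau> > 0\<close>, of "r i" "l i"] by (simp add: w_def omega_def r_def)
    finally show ?thesis by simp
  qed
  then have "(\<Sum>i\<in>UNIV. phi \<tau> (f i (xpart (z + h)) - tpart (z + h)))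
      \<le> (\<Sum>i\<in>UNIV. phi \<tau> (r i) + (1 + r i / w i) / 2 * l i + (l i)\<^sup>2 / (4 * w i)
         + L i / 2 * (norm (xpart h))\<^sup>2)"
    by (rule sum_mono)
  also have "\<dots> = (\<Sum>i\<in>UNIV. phi \<tau> (r i)) + (\<Sum>i\<in>UNIV. (1 + r i / w i) / 2 * l i)
      + 1/4 * (\<Sum>i\<in>UNIV. (l i)\<^sup>2 / w i) + 1/2 * ((\<Sum>i\<in>UNIV. L i) * (norm (xpart h))\<^sup>2)"
    by (simp add: sum.distrib sum_distrib_left sum_distrib_right)
  finally have "Phi \<tau> f (z + h) \<le> Phi \<tau> f z + grad (Phi \<tau> f) z \<bullet> h
      + 1/4 * (\<Sum>i\<in>UNIV. (l i)\<^sup>2 / w i) + 1/2 * ((\<Sum>i\<in>UNIV. L i) * (norm (xpart h))\<^sup>2)"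
    by (simp add: Phi_def grad_Phi_inner[OF diff \<open>\<tau> > 0\<close>] r_def l_def w_def)
  moreover have "0 \<le> \<delta> * (norm h)\<^sup>2"
    using \<open>\<delta> > 0\<close> by simp
  ultimately show ?thesis
    by (simp add: Pmat_quadratic_form l_def w_def add_divide_distrib)
qed

section \<open>Sufficient descent along the enhanced direction\<close>

text \<open>
  The bound \<open>|H p|\<^sup>2 \<le> \<Gamma> \<langle>p, H p\<rangle>\<close> in coordinates. Let \<open>s\<close> have length 1 and let \<open>e\<close> be the unit
  vector in the direction of the part of \<open>q\<close> orthogonal to \<open>s\<close>. If \<open>p\<close> has the components \<open>a\<close> along \<open>s\<close>
  and \<open>p\<^sub>2\<close> along \<open>e\<close>, and a remainder of length \<open>\<rho>\<close>, then \<open>W = \<varpi>\<^sup>2\<close>, \<open>v = - \<varpi> p\<^sub>2\<close> and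
  \<open>N = p\<^sub>2\<^sup>2 + \<rho>\<^sup>2\<close>. With \<open>G = \<Gamma> - 1 - \<varpi>\<^sup>2\<close>, the right side minus the left side is
  \<open>(\<Gamma> - 1) \<rho>\<^sup>2 + (G - \<mu>) (p\<^sub>2\<^sup>2 + (1 + \<mu>) a\<^sup>2) + \<mu> (p\<^sub>2 + \<varpi> a)\<^sup>2\<close>.
  The variables \<open>v\<close> and \<open>N\<close> make sense without \<open>e\<close>, which is undefined if \<open>q\<close> is a multiple of \<open>s\<close>,
  that is, if \<open>W = 0\<close>. Otherwise \<open>p\<^sub>2 = - v / \<varpi>\<close>, and the identity is used multiplied by \<open>W\<close>.
\<close>

lemma planar_direction_bound:
  fixes \<Gamma> W \<mu> N a v :: real
  assumes "0 \<le> W" "0 \<le> N" "v\<^sup>2 \<le> W * N" "0 \<le> \<mu>" "\<mu> \<le> \<Gamma> - 1 - W"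
  shows "(1 + \<mu>)\<^sup>2 * a\<^sup>2 + N + 2 * \<mu> * a * v + v\<^sup>2 + W * a\<^sup>2 \<le> \<Gamma> * (N + (1 + \<mu>) * a\<^sup>2)"
    (is "?lhs \<le> ?rhs")
proof -
  define G where "G = \<Gamma> - 1 - W"
  have G: "0 \<le> \<mu>" "\<mu> \<le> G" "0 \<le> G" and \<Gamma>: "\<Gamma> = 1 + W + G"
    using assms by (auto simp: G_def)
  show ?thesis
  proof (cases "W = 0")
    case True
    then have "v = 0" using assms by simp
    have "?rhs - ?lhs = G * N + (G - \<mu>) * (1 + \<mu>) * a\<^sup>2"
      unfolding \<Gamma> True \<open>v = 0\<close> by (simp add: power2_eq_square algebra_simps)
    also have "\<dots> \<ge> 0"
      using G assms by simp
    finally show ?thesis by simp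
  next
    case False
    have "W * (?rhs - ?lhs) = (W + G) * (W * N - v\<^sup>2) + \<mu> * (v - W * a)\<^sup>2
        + (G - \<mu>) * (v\<^sup>2 + W * (1 + \<mu>) * a\<^sup>2)"
      unfolding \<Gamma> by algebra
    also have "\<dots> \<ge> 0"
      using G assms by simp
    finally show ?thesis
      using False \<open>0 \<le> W\<close> by (simp add: zero_le_mult_iff)
  qed
qed

lemma Cauchy_Schwarz_bilinear:
  fixes Q :: "'a::real_vector \<Rightarrow> 'a \<Rightarrow> real"
  assumes Q: "bilinear Q" and sym: "\<And>x y. Q x y = Q y x" and pos: "\<And>x. x \<noteq> 0 \<Longrightarrow> 0 < Q x x"
  shows "(Q x y)\<^sup>2 \<le> Q x x * Q y y"
proof (cases "y = 0")
  case True
  then show ?thesis by (simp add: bilinear_rzero[OF Q])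
next
  case False
  define t where "t = Q x y / Q y y"
  have y: "0 < Q y y" using pos False .
  have "0 \<le> Q (x - t *\<^sub>R y) (x - t *\<^sub>R y)"
    using pos[of "x - t *\<^sub>R y"] bilinear_rzero[OF Q] by (cases "x - t *\<^sub>R y = 0") auto
  also have "\<dots> = Q x x - 2 * t * Q x y + t\<^sup>2 * Q y y"
    by (simp add: bilinear_lsub[OF Q] bilinear_rsub[OF Q] bilinear_lmul[OF Q] bilinear_rmul[OF Q]
        sym[of y x] power2_eq_square algebra_simps)
  also have "\<dots> = Q x x - (Q x y)\<^sup>2 / Q y y"
    using y by (simp add: t_def field_simps power2_eq_square)
  finally show ?thesis
    using y by (simp add: field_simps)
qed

text \<open>
  The lengths and products that occur depend on \<open>p\<close> only through \<open>a\<close>, \<open>N\<close> and \<open>v\<close> of the planar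
  bound. Its hypothesis \<open>v\<^sup>2 \<le> W N\<close> is the Cauchy--Schwarz inequality for the parts of \<open>p\<close> and \<open>q\<close>
  orthogonal to \<open>s\<close>, that is, nonnegativity of the Gram determinant of \<open>p\<close>, \<open>s\<close> and \<open>q\<close>.
\<close>

lemma unit_three_term_direction_bound:
  fixes Q :: "'a::real_vector \<Rightarrow> 'a \<Rightarrow> real"
  assumes Q: "bilinear Q" and sym: "\<And>x y. Q x y = Q y x" and pos: "\<And>x. x \<noteq> 0 \<Longrightarrow> 0 < Q x x"
    and s: "Q s s = 1" and q: "Q q q = 1"
    and "\<theta> > 1" "0 \<le> \<mu>"
    and \<mu>: "\<mu> \<le> \<Gamma> - 1 - (1 - (Q s q)\<^sup>2) / (\<theta> + Q s q)\<^sup>2"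
    and d: "d = - p + (Q p q / (\<theta> + Q s q) - \<mu> * Q p s) *\<^sub>R s - (Q p s / (\<theta> + Q s q)) *\<^sub>R q"
  shows "Q d d \<le> \<Gamma> * (- Q p d)"
proof -
  note bilin = bilinear_ladd[OF Q] bilinear_radd[OF Q] bilinear_lsub[OF Q] bilinear_rsub[OF Q]
    bilinear_lmul[OF Q] bilinear_rmul[OF Q] bilinear_lneg[OF Q] bilinear_rneg[OF Q]
  define \<kappa> a \<beta> w where "\<kappa> = Q s q" and "a = Q p s" and "\<beta> = Q p q" and "w = \<theta> + \<kappa>"
  define N W v where "N = Q p p - a\<^sup>2" and "W = (1 - \<kappa>\<^sup>2) / w\<^sup>2" and "v = (\<kappa> * a - \<beta>) / w"
  have sq: "Q s q = \<kappa>" "Q q s = \<kappa>" and ps: "Q p s = a" "Q s p = a"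
    and pq: "Q p q = \<beta>" "Q q p = \<beta>"
    by (simp_all add: \<kappa>_def a_def \<beta>_def sym)
  have CS: "(Q x y)\<^sup>2 \<le> Q x x * Q y y" for x y
    by (rule Cauchy_Schwarz_bilinear[OF Q sym pos])
  have \<kappa>: "\<kappa>\<^sup>2 \<le> 1"
    using CS[of s q] by (simp add: s q \<kappa>_def)
  then have "\<bar>\<kappa>\<bar> \<le> 1"
    by (simp add: abs_square_le_1)
  then have w: "w > 0"
    using \<open>\<theta> > 1\<close> by (simp add: w_def)
  have N: "0 \<le> N"
    using CS[of p s] by (simp add: s N_def a_def)
  have W: "0 \<le> W"
    using \<kappa> by (simp add: W_def)
  have "(\<kappa> * a - \<beta>)\<^sup>2 \<le> (1 - \<kappa>\<^sup>2) * N"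
  proof -
    have "Q (q - \<kappa> *\<^sub>R s) (p - a *\<^sub>R s) = \<beta> - \<kappa> * a"
      "Q (q - \<kappa> *\<^sub>R s) (q - \<kappa> *\<^sub>R s) = 1 - \<kappa>\<^sup>2" "Q (p - a *\<^sub>R s) (p - a *\<^sub>R s) = N"
      by (simp_all add: bilin s q sq ps pq N_def power2_eq_square algebra_simps)
    with CS[of "q - \<kappa> *\<^sub>R s" "p - a *\<^sub>R s"] show ?thesis
      by (simp add: power2_commute)
  qed
  then have v: "v\<^sup>2 \<le> W * N"
    using w by (simp add: v_def W_def power_divide divide_right_mono)
  have d': "d = - p + (\<beta> / w - \<mu> * a) *\<^sub>R s - (a / w) *\<^sub>R q"
    by (simp add: d sq ps pq w_def)
  have pd: "- Q p d = N + (1 + \<mu>) * a\<^sup>2"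
    by (simp add: d' bilin ps pq N_def power2_eq_square algebra_simps)
  have "Q d d = Q p p + (\<beta> / w - \<mu> * a)\<^sup>2 + (a / w)\<^sup>2 + 2 * \<mu> * a\<^sup>2
      - 2 * (\<beta> / w - \<mu> * a) * (a / w) * \<kappa>"
    by (simp add: d' bilin s q sq ps pq power2_eq_square algebra_simps)
  also have "\<dots> = (1 + \<mu>)\<^sup>2 * a\<^sup>2 + N + 2 * \<mu> * a * v + v\<^sup>2 + W * a\<^sup>2"
    using w by (simp add: N_def v_def W_def power_divide power2_eq_square field_simps)
  finally show ?thesis
    using planar_direction_bound[OF W N v \<open>0 \<le> \<mu>\<close>, of \<Gamma> a] \<mu> pd
    by (simp add: W_def w_def \<kappa>_def)
qed

text \<open>
  Normalising \<open>s\<close> and \<open>q = P\<^sup>-\<^sup>1 b\<close> to unit length in the inner product of \<open>P\<close> removes \<open>C\<close> and \<open>B\<close>: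
  \<open>\<chi>\<close> becomes the cosine of the angle between them, \<open>D\<close> becomes \<open>\<theta> + \<chi>\<close>, and \<open>g \<bullet> x\<close> is \<open>\<langle>p, x\<rangle>\<close>.
\<close>

lemma direction_sufficient_descent:
  fixes P :: "real^'d^'d" and s b g :: "real^'d"
  assumes sym: "transpose P = P" and pos: "\<And>x. x \<noteq> 0 \<Longrightarrow> 0 < x \<bullet> (P *v x)"
    and "\<theta> > 1" "s \<noteq> 0" "b \<noteq> 0" "0 \<le> \<mu>" "\<mu> \<le> mu_star \<theta> P s b"
  defines "d \<equiv> direction \<theta> \<mu> P s b g"
  shows "d \<bullet> (P *v d) \<le> Gamma0 \<theta> * (- (g \<bullet> d))"
proof -
  define Q where "Q x y = x \<bullet> (P *v y)" for x y
  have Q: "bilinear Q"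
    unfolding bilinear_def Q_def[abs_def]
    by (auto intro!: linearI simp: inner_add_left matrix_vector_right_distrib inner_add_right
        matrix_vector_mult_scaleR)
  have Qsym: "Q x y = Q y x" for x y
    by (metis Q_def sym dot_lmul_matrix inner_commute transpose_matrix_vector)
  have Qpos: "x \<noteq> 0 \<Longrightarrow> 0 < Q x x" for x
    unfolding Q_def by (rule pos)
  have "invertible P"
  proof -
    have "x = 0" if "P *v x = 0" for x
      using pos[of x] that by force
    then show ?thesis
      by (simp add: invertible_left_inverse matrix_left_invertible_ker)
  qed
  then have "P ** matrix_inv P = mat 1"
    unfolding invertible_def matrix_inv_def by (rule someI_ex[THEN conjunct1])
  then have PP: "P *v (matrix_inv P *v y) = y" for y
    by (simp add: matrix_vector_mul_assoc)
  define p q where "p = matrix_inv P *v g" and "q = matrix_inv P *v b"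
  define C B where "C = Q s s" and "B = Q q q"
  have Qp: "Q x p = g \<bullet> x" "Q p x = g \<bullet> x" and Qq: "Q x q = x \<bullet> b" "Q q x = x \<bullet> b" for x
    using Qsym[of p x] Qsym[of q x]
    by (simp_all add: Q_def p_def q_def PP inner_commute)
  have "q \<noteq> 0"
    using PP[of b] \<open>b \<noteq> 0\<close> by (auto simp: q_def)
  then have CB: "C > 0" "B > 0"
    using Qpos \<open>s \<noteq> 0\<close> by (auto simp: C_def B_def)
  have C: "Cval P s = C" and B: "Bval P b = B"
    by (simp_all add: Cval_def Bval_def C_def B_def Q_def q_def PP inner_commute)
  define s' q' where "s' = s /\<^sub>R sqrt C" and "q' = q /\<^sub>R sqrt B"
  note bilin = bilinear_lmul[OF Q] bilinear_rmul[OF Q]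
  have unit: "Q s' s' = 1" "Q q' q' = 1"
    using CB by (simp_all add: s'_def q'_def bilin C_def[symmetric] B_def[symmetric] field_simps)
  have \<kappa>: "Q s' q' = chi P s b"
    by (simp add: s'_def q'_def bilin Qq chi_def C B real_sqrt_mult field_simps)
  have "(Q s' q')\<^sup>2 \<le> 1"
    using Cauchy_Schwarz_bilinear[OF Q Qsym Qpos, of s' q'] by (simp add: unit)
  then have w: "\<theta> + Q s' q' > 0"
    using \<open>\<theta> > 1\<close> by (auto simp: abs_square_le_1)
  have D: "Dval \<theta> P s b = sqrt C * sqrt B * (\<theta> + Q s' q')"
    using CB by (simp add: Dval_def \<kappa> chi_def C B real_sqrt_mult field_simps)
  have dir: "d = - p + (Q p q' / (\<theta> + Q s' q') - \<mu> * Q p s') *\<^sub>R s' - (Q p s' / (\<theta> + Q s' q')) *\<^sub>R q'"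
  proof -
    have gq: "g \<bullet> q = sqrt B * Q p q'" and gs: "g \<bullet> s = sqrt C * Q p s'"
      using CB by (simp_all add: Qp s'_def q'_def)
    have "sqrt C / C = 1 / sqrt C"
      using CB by (simp add: field_simps)
    then have "(g \<bullet> s) / C = Q p s' / sqrt C"
      by (simp add: gs) (metis times_divide_eq_left mult.left_neutral)
    then have "(g \<bullet> q) / Dval \<theta> P s b - \<mu> * ((g \<bullet> s) / C)
        = (Q p q' / (\<theta> + Q s' q') - \<mu> * Q p s') / sqrt C"
      using CB w by (simp add: D gq gs diff_divide_distrib)
    moreover have "(g \<bullet> s) / Dval \<theta> P s b = Q p s' / (\<theta> + Q s' q') / sqrt B"
      using CB w by (simp add: D gs)
    ultimately show ?thesis
      unfolding d_def direction_def p_def[symmetric] q_def[symmetric] C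
      by (simp add: s'_def q'_def divide_inverse)
  qed
  define G where "G = Gamma0 \<theta> - 1 - varpi_sq \<theta> P s b"
  have "1 < \<theta>\<^sup>2"
    using \<open>\<theta> > 1\<close> by (simp add: one_less_power)
  then have \<Gamma>: "0 \<le> sqrt (Gamma0 \<theta>)"
    by (simp add: Gamma0_def)
  have "\<mu> * 1 \<le> \<mu> * (sqrt (Gamma0 \<theta>) + 1)"
    using \<open>0 \<le> \<mu>\<close> \<Gamma> by (intro mult_left_mono) auto
  also have "\<dots> \<le> G"
    using \<open>\<mu> \<le> mu_star \<theta> P s b\<close> \<Gamma> by (simp add: mu_star_def G_def pos_le_divide_eq)
  finally have "\<mu> \<le> G"
    by simp
  then have "\<mu> \<le> Gamma0 \<theta> - 1 - (1 - (Q s' q')\<^sup>2) / (\<theta> + Q s' q')\<^sup>2"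
    by (simp add: G_def varpi_sq_def \<kappa>)
  from unit_three_term_direction_bound[OF Q Qsym Qpos unit \<open>\<theta> > 1\<close> \<open>0 \<le> \<mu>\<close> this dir]
  show ?thesis
    by (simp add: Qp) (simp add: Q_def)
qed

section \<open>Armijo steps\<close>

theorem theorem6p1:
  fixes f :: "'m::finite \<Rightarrow> real^'n::finite \<Rightarrow> real"
    and L :: "'m \<Rightarrow> real"
    and \<tau> \<delta> c1 \<theta> \<mu> \<alpha> :: real
    and z_prev z s b g d :: "real^('n option)"
    and P :: "real^('n option)^('n option)"
  assumes f_diff: "\<And>i x. f i differentiable (at x)"
    and f_C1: "\<And>i. continuous_on UNIV (grad (f i))"
    and f_lip: "\<And>i. (L i)-lipschitz_on UNIV (grad (f i))"
    and "\<tau> > 0" and "\<delta> > 0"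
    and "0 < c1" and "c1 < 1" and "\<theta> > 1"
    and "z_prev \<noteq> z" and s: "s = z - z_prev"
    and "b \<noteq> 0"
    and g: "g = grad (Phi \<tau> f) z"
    and P: "P = Pmat \<tau> \<delta> L f z"
    and "0 \<le> \<mu>" and "\<mu> \<le> mu_star \<theta> P s b"
    and d: "d = direction \<theta> \<mu> P s b g"
    and "0 < \<alpha>" and "\<alpha> \<le> 2 * (1 - c1) * (1 - 1 / \<theta>\<^sup>2)"
  shows "Phi \<tau> f (z + \<alpha> *\<^sub>R d) \<le> Phi \<tau> f z + c1 * \<alpha> * (g \<bullet> d)"
proof -
  define E where "E = d \<bullet> (P *v d)"
  have pos: "x \<noteq> 0 \<Longrightarrow> 0 < x \<bullet> (P *v x)" for x
    unfolding P using \<open>\<delta> > 0\<close> lipschitz_on_nonneg[OF f_lip] by (rule Pmat_positive_definite)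
  have "1 < \<theta>\<^sup>2"
    using \<open>\<theta> > 1\<close> by (simp add: one_less_power)
  have "E \<le> Gamma0 \<theta> * (- (g \<bullet> d))"
    unfolding E_def d
    by (rule direction_sufficient_descent) (use assms pos in \<open>auto simp: Pmat_symmetric\<close>)
  then have "(1 - 1 / \<theta>\<^sup>2) * E \<le> (1 - 1 / \<theta>\<^sup>2) * (Gamma0 \<theta> * (- (g \<bullet> d)))"
    using \<open>1 < \<theta>\<^sup>2\<close> by (intro mult_left_mono) (auto simp: divide_le_eq)
  also have "\<dots> = - (g \<bullet> d)"
    using \<open>\<theta> > 1\<close> \<open>1 < \<theta>\<^sup>2\<close> by (simp add: Gamma0_def field_simps)
  finally have descent: "(1 - 1 / \<theta>\<^sup>2) * E \<le> - (g \<bullet> d)" .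
  have "0 \<le> E"
    using pos[of d] by (cases "d = 0") (auto simp: E_def)
  then have "\<alpha> * E \<le> 2 * (1 - c1) * ((1 - 1 / \<theta>\<^sup>2) * E)"
    using mult_right_mono[OF \<open>\<alpha> \<le> 2 * (1 - c1) * (1 - 1 / \<theta>\<^sup>2)\<close>] by (simp add: mult.assoc)
  also have "\<dots> \<le> 2 * (1 - c1) * (- (g \<bullet> d))"
    using descent \<open>c1 < 1\<close> by (intro mult_left_mono) auto
  finally have "\<alpha> * (\<alpha> * E) \<le> \<alpha> * (2 * (1 - c1) * (- (g \<bullet> d)))"
    using \<open>0 < \<alpha>\<close> by (intro mult_left_mono) auto
  then have "\<alpha> * (g \<bullet> d) + 1/2 * (\<alpha> * (\<alpha> * E)) \<le> c1 * \<alpha> * (g \<bullet> d)"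
    by (simp add: algebra_simps)
  moreover have "Phi \<tau> f (z + \<alpha> *\<^sub>R d) \<le> Phi \<tau> f z + \<alpha> * (g \<bullet> d) + 1/2 * (\<alpha> * (\<alpha> * E))"
    using Phi_le_quadratic_model[OF f_diff f_lip \<open>\<tau> > 0\<close> \<open>\<delta> > 0\<close>, where z = z and h = "\<alpha> *\<^sub>R d"]
    by (simp add: g P E_def matrix_vector_mult_scaleR)
  ultimately show ?thesis by simp
qed

end
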